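(* Let $n\ge 2$ be an integer and let $$p_{2n}(x)=\frac{x^{2n}}{2n}+\frac{x^2}{2}+1.$$ Then the polynomial $(2n-1)\left(p_{2n}'(x)\right)^2-2n\,p_{2n}(x)\,p_{2n}''(x)$ has no real zeros, that is $$Z_{\mathbb R}\left[(2n-1)\left(p_{2n}'\right)^2-2n\,p_{2n}\,p_{2n}''\right]=0.$$
   Context: For a real polynomial $f$, $Z_{\mathbb R}(f)$ denotes the number of real zeros of $f$ counted with multiplicity. *)

theory Defs
  imports "HOL-Computational_Algebra.Computational_Algebra"
begin

(* The multiset of roots of the zero polynomial is empty by convention, so
   real_zero_count 0 = 0; for f \<noteq> 0 this is the number of real zeros of f,
   each counted as often as its order. *)
definition real_zero_count :: "real poly \<Rightarrow> nat"
  where "real_zero_count f = size (proots f)"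

definition p_even :: "nat \<Rightarrow> real poly"
  where "p_even n = monom (1 / (2 * real n)) (2 * n) + monom (1 / 2) 2 + 1"

lemma poly_p_even:
  "poly (p_even n) x = x ^ (2 * n) / (2 * real n) + x\<^sup>2 / 2 + 1"
  by (simp add: p_even_def poly_monom)

end

theory Submission
  imports Defs
begin

text \<open>
  Put \<open>u = x\<^sup>2\<close> and \<open>y = u ^ (n - 1)\<close>. The terms in \<open>u y\<^sup>2\<close> cancel, and the polynomial evaluates to
  \<open>(n - 1) u - (n - 1) (2 n - 3) u y - 2 n (2 n - 1) y - 2 n\<close>. Only the first term can be
  positive, and it is dominated by \<open>2 n\<close> if \<open>u \<le> 1\<close> and by \<open>2 n (2 n - 1) y\<close> if \<open>u \<ge> 1\<close>.
\<close>

text \<open>The odd power in the derivative is split as \<open>x\<close> times a power of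
  \<open>x^2\<close>, so that its square becomes \<open>u * (y + 1)^2\<close>.\<close>

lemma poly_pderiv_p_even:
  assumes "n \<ge> 1"
  shows "poly (pderiv (p_even n)) x = x * ((x\<^sup>2) ^ (n - 1) + 1)"
proof -
  \<comment> \<open>With \<open>n = Suc k\<close> the truncated subtraction \<open>n - 1\<close>
    simplifies to \<open>k\<close>.\<close>
  obtain k where "n = Suc k"
    using assms by (cases n) auto
  then show ?thesis
    by (simp add: p_even_def pderiv_add pderiv_monom poly_monom field_simps flip: power_mult)
qed

lemma poly_pderiv_pderiv_p_even:
  assumes "n \<ge> 1"
  shows "poly (pderiv (pderiv (p_even n))) x = (2 * real n - 1) * (x\<^sup>2) ^ (n - 1) + 1"
proof -
  obtain k where "n = Suc k"
    using assms by (cases n) auto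
  then show ?thesis
    by (simp add: p_even_def pderiv_add pderiv_monom poly_monom field_simps flip: power_mult)
qed

lemma real_zero_count_eq_0:
  assumes "\<And>x. poly f x \<noteq> 0"
  shows "real_zero_count f = 0"
proof -
  \<comment> \<open>Only for a nonzero polynomial is the support of \<open>proots\<close> the set of
    roots.\<close>
  have "f \<noteq> 0"
    using assms by auto
  then have "set_mset (proots f) = {}"
    using assms by simp
  then show ?thesis
    by (simp add: real_zero_count_def)
qed

theorem proposition2p11:
  fixes n :: nat
  assumes "n \<ge> 2"
  defines "q \<equiv> smult (2 * real n - 1) ((pderiv (p_even n))\<^sup>2)
                - smult (2 * real n) (p_even n * pderiv (pderiv (p_even n)))"
  shows "(\<forall>x::real. poly q x \<noteq> 0) \<and> real_zero_count q = 0"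
proof -
  have "poly q x < 0" for x
  proof -
    define N u y where "N = real n" and "u = x\<^sup>2" and "y = u ^ (n - 1)"
    have N: "N \<ge> 2" and u: "u \<ge> 0" and y: "y \<ge> 0"
      using assms by (simp_all add: N_def u_def y_def)
    have "x ^ (2 * n) = u * y"
      using assms by (simp add: u_def y_def power_mult flip: power_Suc)
    then have p: "poly (p_even n) x = u * y / (2 * N) + u / 2 + 1"
      by (simp add: poly_p_even N_def u_def)
    have p': "poly (pderiv (p_even n)) x = x * (y + 1)"
      using assms(1) poly_pderiv_p_even[of n x] by (simp add: y_def u_def)
    have p'': "poly (pderiv (pderiv (p_even n))) x = (2 * N - 1) * y + 1"
      using assms(1) poly_pderiv_pderiv_p_even[of n x] by (simp add: N_def y_def u_def)
    have "poly q x = (2 * N - 1) * (u * (y + 1)\<^sup>2)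
        - 2 * N * ((u * y / (2 * N) + u / 2 + 1) * ((2 * N - 1) * y + 1))"
      by (simp add: q_def p p' p'' power_mult_distrib flip: N_def u_def)
    \<comment> \<open>The factor \<open>2 * N\<close> clears the denominator of
      \<open>u * y / (2 * N)\<close>, so both products contain
      \<open>(2 * N - 1) * u * y^2\<close>.\<close>
    also have "\<dots> = (N - 1) * u - (N - 1) * (2 * N - 3) * (u * y) - 2 * N * (2 * N - 1) * y - 2 * N"
      using N by (simp add: field_simps power2_eq_square)
    also have "\<dots> < 0"
    proof -
      have uy: "(N - 1) * (2 * N - 3) * (u * y) \<ge> 0"
        using N u y by simp
      have "(N - 1) * u < 2 * N * (2 * N - 1) * y + 2 * N"
      proof (cases "u \<le> 1")
        case True
        have "(N - 1) * u \<le> N - 1"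
          using True N by (simp add: mult_left_le)
        also have "\<dots> < 2 * N"
          using N by simp
        also have "\<dots> \<le> 2 * N * (2 * N - 1) * y + 2 * N"
          using N y by simp
        finally show ?thesis .
      next
        case False
        \<comment> \<open>As \<open>n - 1 \<ge> 1\<close> and \<open>u > 1\<close>, the first power
          of \<open>u\<close> is at most \<open>u ^ (n - 1)\<close>.\<close>
        then have "u \<le> y"
          using assms(1) power_increasing[of 1 "n - 1" u] by (simp add: y_def)
        moreover have "N - 1 \<le> 2 * N * (2 * N - 1)"
          using N mult_mono[of 1 "2 * N" "N - 1" "2 * N - 1"] by simp
        ultimately have "(N - 1) * u \<le> 2 * N * (2 * N - 1) * y"
          using N u by (intro mult_mono) auto
        then show ?thesis
          using N by linarith
      qed
      then show ?thesis
        using uy by linarith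
    qed
    finally show ?thesis .
  qed
  then have "poly q x \<noteq> 0" for x
    by (metis less_irrefl)
  then show ?thesis
    using real_zero_count_eq_0 by blast
qed

end
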